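(* For $0\le\theta\le1$ let $(X,Y)$ have Gumbel's bivariate exponential distribution (GBED-I) with parameter $\theta$, that is, joint distribution function $F_{12}(x,y)=1-e^{-x}-e^{-y}+e^{-(x+y+\theta xy)}$ for $x,y>0$ (and $0$ otherwise), and let $\kappa(\theta)=\kappa(X,Y)$ be Bergsma's covariance of $(X,Y)$. Then $\kappa(\theta)$ is an increasing function of $\theta\in(0,1)$.
   Context: For a distribution function $F$ on $\mathbb{R}$ with finite mean, with $Z_1,Z_2$ i.i.d. $F$, define $h_F(z_1,z_2)=-\tfrac12\,\mathbb{E}\big(|z_1-z_2|-|z_1-Z_2|-|Z_1-z_2|+|Z_1-Z_2|\big)$. For a bivariate random variable $(X,Y)$ with marginal distribution functions $F_1,F_2$ of finite variance, Bergsma's covariance is $\kappa(X,Y)=\mathbb{E}[h_{F_1}(X_1,X_2)\,h_{F_2}(Y_1,Y_2)]$, where $(X_1,Y_1),(X_2,Y_2)$ are i.i.d. copies of $(X,Y)$. *)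

theory Defs
  imports "HOL-Probability.Probability"
begin

(* The kernel h_F, for F a distribution function: Z1 and Z2 are the two coordinates of the
   product of two copies of the law interval_measure F, the law with distribution function F. *)
definition bergsma_kernel :: "(real \<Rightarrow> real) \<Rightarrow> real \<Rightarrow> real \<Rightarrow> real" where
  "bergsma_kernel F z1 z2 =
     - (1 / 2) * (\<integral>Z. (\<bar>z1 - z2\<bar> - \<bar>z1 - snd Z\<bar> - \<bar>fst Z - z2\<bar> + \<bar>fst Z - snd Z\<bar>)
        \<partial>(interval_measure F \<Otimes>\<^sub>M interval_measure F))"

(* The i.i.d. copies (X1,Y1) and (X2,Y2) of (X,Y) are the two coordinates of P \<Otimes>\<^sub>M P. *)
definition bergsma_cov :: "'a measure \<Rightarrow> ('a \<Rightarrow> real) \<Rightarrow> ('a \<Rightarrow> real) \<Rightarrow> real" where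
  "bergsma_cov M X Y =
     (let F1 = cdf (distr M borel X);
          F2 = cdf (distr M borel Y);
          P = distr M (borel \<Otimes>\<^sub>M borel) (\<lambda>\<omega>. (X \<omega>, Y \<omega>))
      in \<integral>((x1, y1), (x2, y2)). bergsma_kernel F1 x1 x2 * bergsma_kernel F2 y1 y2 \<partial>(P \<Otimes>\<^sub>M P))"

definition gbed_cdf :: "real \<Rightarrow> real \<Rightarrow> real \<Rightarrow> real" where
  "gbed_cdf \<theta> x y =
     (if 0 < x \<and> 0 < y then 1 - exp (- x) - exp (- y) + exp (- (x + y + \<theta> * x * y)) else 0)"

definition has_gbed :: "'a measure \<Rightarrow> ('a \<Rightarrow> real) \<Rightarrow> ('a \<Rightarrow> real) \<Rightarrow> real \<Rightarrow> bool" where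
  "has_gbed M X Y \<theta> \<longleftrightarrow>
     prob_space M \<and> X \<in> borel_measurable M \<and> Y \<in> borel_measurable M \<and>
     (\<forall>x y. measure M {\<omega> \<in> space M. X \<omega> \<le> x \<and> Y \<omega> \<le> y} = gbed_cdf \<theta> x y)"

end

theory Submission
  imports Defs
begin

text \<open>Bergsma's covariance is a squared distance from independence. Write $F_1, F_2$ for the marginal
  distribution functions of $(X,Y)$ and $F_{12}$ for the joint one. Then
  \[ \kappa(X,Y) = \int\int (F_{12}(s,t) - F_1(s) F_2(t))^2 \, ds \, dt, \]
  and for Gumbel's distribution the integrand equals
  $e^{-2(s+t)} (1 - e^{-\theta s t})^2$ for $s, t > 0$ and vanishes elsewhere. At each point of the
  open quadrant this is strictly increasing in $\theta$, and the quadrant has positive measure, so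
  the integral is strictly increasing too.

  The formula for $\kappa$ rests on $|a-b| = \int |1_{a \le t} - 1_{b \le t}| \, dt$. Since the
  absolute value in the integrand may be replaced by a square, the four distances in the kernel
  combine to the integral of one product of two differences of steps
  (\<open>has_bochner_integral_step_product\<close>); averaging over the independent copies replaces the
  subtracted steps by their mean $F$ (\<open>bergsma_kernel_eq\<close>):
  \[ h_F(z_1,z_2) = \int (1_{z_1 \le t} - F(t)) (1_{z_2 \le t} - F(t)) \, dt. \]
  In $\mathbb{E}[h_{F_1}(X_1,X_2) h_{F_2}(Y_1,Y_2)]$ the integrals over $s$ and $t$ are
  exchanged with the expectation. For fixed $(s,t)$ the two copies of $(X,Y)$ contribute
  equal independent factors, each of mean $F_{12}(s,t) - F_1(s) F_2(t)$; hence the square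
  (\<open>bergsma_cov_has_integral\<close>). Finite means of $X$ and $Y$ justify the exchange.\<close>

section \<open>Products of functions on a product space\<close>

lemma has_bochner_integral_pair_mult:
  fixes f :: "'a \<Rightarrow> real" and g :: "'b \<Rightarrow> real"
  assumes P: "sigma_finite_measure P" and Q: "sigma_finite_measure Q"
    and f: "integrable P f" and g: "integrable Q g"
  shows "has_bochner_integral (P \<Otimes>\<^sub>M Q) (\<lambda>(x, y). f x * g y) (integral\<^sup>L P f * integral\<^sup>L Q g)"
proof -
  interpret pair_sigma_finite P Q
    using P Q by (simp add: pair_sigma_finite_def)
  have [measurable]: "f \<in> borel_measurable P" "g \<in> borel_measurable Q"
    using f g by auto
  have int: "integrable (P \<Otimes>\<^sub>M Q) (\<lambda>(x, y). f x * g y)"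
    by (rule Fubini_integrable) (use f g in \<open>auto simp: abs_mult\<close>)
  moreover have "integral\<^sup>L (P \<Otimes>\<^sub>M Q) (\<lambda>(x, y). f x * g y) = integral\<^sup>L P f * integral\<^sup>L Q g"
    using integral_fst'[OF int] by simp
  ultimately show ?thesis
    by (simp add: has_bochner_integral_iff)
qed

section \<open>The kernel as an integral of centred step functions\<close>

definition step :: "real \<Rightarrow> real \<Rightarrow> real" where
  "step z t = (if z \<le> t then 1 else 0)"

lemma measurable_step [measurable (raw)]:
  assumes [measurable]: "f \<in> borel_measurable N" "g \<in> borel_measurable N"
  shows "(\<lambda>x. step (f x) (g x)) \<in> borel_measurable N"
  unfolding step_def by measurable

lemma has_bochner_integral_step_dist:
  "has_bochner_integral lborel (\<lambda>t. \<bar>step a t - step b t\<bar>) \<bar>a - b\<bar>"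
proof -
  have *: "has_bochner_integral lborel (\<lambda>t. \<bar>step a t - step b t\<bar>) (b - a)" if "a \<le> b" for a b
  proof -
    have "(\<lambda>t. \<bar>step a t - step b t\<bar>) = indicator {a..<b}"
      using that by (auto simp: step_def fun_eq_iff split: split_indicator)
    moreover have "has_bochner_integral lborel (indicator {a..<b}) (measure lborel {a..<b})"
      by (rule has_bochner_integral_real_indicator) (use that in auto)
    ultimately show ?thesis using that by simp
  qed
  show ?thesis
    using *[of a b] *[of b a] by (cases "a \<le> b") (auto simp: abs_minus_commute)
qed

text \<open>A difference of two steps takes the values -1, 0 and 1 only, so its square integrates to the
  distance of the jumps. Polarisation then expresses the four distances in Bergsma's kernel by one
  product.\<close>

lemma has_bochner_integral_step_product:
  "has_bochner_integral lborel (\<lambda>t. (step z1 t - step w1 t) * (step z2 t - step w2 t))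
     (- (1 / 2) * (\<bar>z1 - z2\<bar> - \<bar>z1 - w2\<bar> - \<bar>w1 - z2\<bar> + \<bar>w1 - w2\<bar>))"
proof -
  have "has_bochner_integral lborel
      (\<lambda>t. - (1 / 2) * (\<bar>step z1 t - step z2 t\<bar> - \<bar>step z1 t - step w2 t\<bar>
         - \<bar>step w1 t - step z2 t\<bar> + \<bar>step w1 t - step w2 t\<bar>))
      (- (1 / 2) * (\<bar>z1 - z2\<bar> - \<bar>z1 - w2\<bar> - \<bar>w1 - z2\<bar> + \<bar>w1 - w2\<bar>))"
    by (intro has_bochner_integral_mult_right has_bochner_integral_add has_bochner_integral_diff
        has_bochner_integral_step_dist)
  moreover have "- (1 / 2) * (\<bar>step z1 t - step z2 t\<bar> - \<bar>step z1 t - step w2 t\<bar>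
         - \<bar>step w1 t - step z2 t\<bar> + \<bar>step w1 t - step w2 t\<bar>)
      = (step z1 t - step w1 t) * (step z2 t - step w2 t)" for t
    by (simp add: step_def)
  ultimately show ?thesis by simp
qed

definition centred_step :: "real measure \<Rightarrow> real \<Rightarrow> real \<Rightarrow> real" where
  "centred_step \<mu> z t = step z t - cdf \<mu> t"

locale finite_mean_distribution = real_distribution \<mu> for \<mu> :: "real measure" +
  assumes integrable_id: "integrable \<mu> (\<lambda>z. z)"
begin

lemma measurable_cdf [measurable]: "cdf \<mu> \<in> borel_measurable borel"
  by (intro borel_measurable_mono monoI cdf_nondecreasing)

lemma measurable_centred_step [measurable (raw)]:
  assumes [measurable]: "f \<in> borel_measurable N" "g \<in> borel_measurable N"
  shows "(\<lambda>x. centred_step \<mu> (f x) (g x)) \<in> borel_measurable N"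
  unfolding centred_step_def by measurable

lemma abs_centred_step_le_1: "\<bar>centred_step \<mu> z t\<bar> \<le> 1"
  using cdf_nonneg[of t] cdf_bounded_prob[of t] by (auto simp: centred_step_def step_def)

lemma integrable_step: "integrable \<mu> (\<lambda>z. step z t)"
  by (rule integrable_const_bound[where B=1]) (auto simp: step_def)

lemma integral_step: "(\<integral>z. step z t \<partial>\<mu>) = cdf \<mu> t"
proof -
  have "(\<lambda>z. step z t) = indicator {..t}"
    by (auto simp: step_def fun_eq_iff split: split_indicator)
  then show ?thesis by (simp add: cdf_def)
qed

lemma has_bochner_integral_step_diff:
  "has_bochner_integral \<mu> (\<lambda>w. step z t - step w t) (centred_step \<mu> z t)"
  using integrable_step[of t] prob_space
  by (simp add: has_bochner_integral_iff integral_step centred_step_def)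

lemma integrable_dist: "integrable \<mu> (\<lambda>w. \<bar>z - w\<bar>)"
  using integrable_id by simp

text \<open>The centred step is the mean of the differences of two steps, so the integral of its absolute
  value is at most the mean distance from its jump, and the triangle inequality bounds that.\<close>

lemma
  shows integrable_centred_step: "integrable lborel (centred_step \<mu> z)"
    and integral_abs_centred_step_le:
      "(\<integral>t. \<bar>centred_step \<mu> z t\<bar> \<partial>lborel) \<le> \<bar>z\<bar> + (\<integral>w. \<bar>w\<bar> \<partial>\<mu>)"
proof -
  interpret pair_sigma_finite \<mu> lborel ..
  have int: "integrable (\<mu> \<Otimes>\<^sub>M lborel) (\<lambda>(w, t). step z t - step w t)"
  proof (rule Fubini_integrable)
    show "integrable \<mu> (\<lambda>w. \<integral>t. norm (case (w, t) of (w, t) \<Rightarrow> step z t - step w t) \<partial>lborel)"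
      using has_bochner_integral_step_dist[of z] integrable_dist
      by (simp add: has_bochner_integral_iff)
    have "integrable lborel (\<lambda>t. step z t - step w t)" for w
      using has_bochner_integral_step_dist[of z w]
      by (subst integrable_abs_iff[symmetric]) (auto simp: has_bochner_integral_iff)
    then show "AE w in \<mu>. integrable lborel (\<lambda>t. case (w, t) of (w, t) \<Rightarrow> step z t - step w t)"
      by simp
  qed simp
  have eq: "(\<integral>w. step z t - step w t \<partial>\<mu>) = centred_step \<mu> z t" for t
    using has_bochner_integral_step_diff by (simp add: has_bochner_integral_iff)
  show c: "integrable lborel (centred_step \<mu> z)"
    using integrable_snd[OF int] by (simp add: eq cong: integrable_cong)
  have int': "integrable (\<mu> \<Otimes>\<^sub>M lborel) (\<lambda>(w, t). \<bar>step z t - step w t\<bar>)"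
    using integrable_abs[OF int] by (simp add: case_prod_unfold)
  have "(\<integral>t. \<bar>centred_step \<mu> z t\<bar> \<partial>lborel) \<le> (\<integral>t. (\<integral>w. \<bar>step z t - step w t\<bar> \<partial>\<mu>) \<partial>lborel)"
  proof (rule integral_mono)
    show "\<bar>centred_step \<mu> z t\<bar> \<le> (\<integral>w. \<bar>step z t - step w t\<bar> \<partial>\<mu>)" for t
      by (subst eq[symmetric]) (rule integral_abs_bound)
  qed (use c integrable_snd[OF int'] in auto)
  also have "\<dots> = (\<integral>w. (\<integral>t. \<bar>step z t - step w t\<bar> \<partial>lborel) \<partial>\<mu>)"
    by (rule Fubini_integral[OF int'])
  also have "\<dots> = (\<integral>w. \<bar>z - w\<bar> \<partial>\<mu>)"
    using has_bochner_integral_step_dist by (simp add: has_bochner_integral_iff)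
  also have "\<dots> \<le> (\<integral>w. \<bar>z\<bar> + \<bar>w\<bar> \<partial>\<mu>)"
    using integrable_id by (intro integral_mono integrable_dist) auto
  also have "\<dots> = \<bar>z\<bar> + (\<integral>w. \<bar>w\<bar> \<partial>\<mu>)"
    using integrable_id prob_space by simp
  finally show "(\<integral>t. \<bar>centred_step \<mu> z t\<bar> \<partial>lborel) \<le> \<bar>z\<bar> + (\<integral>w. \<bar>w\<bar> \<partial>\<mu>)" .
qed

lemma integrable_centred_step_product:
  "integrable lborel (\<lambda>t. centred_step \<mu> z1 t * centred_step \<mu> z2 t)"
  by (rule Bochner_Integration.integrable_bound[OF integrable_centred_step[of z1]])
     (auto simp: abs_mult intro!: mult_left_le abs_centred_step_le_1)

text \<open>One factor is bounded by 1 and the other integrated. Either argument can be the one that remains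
  in the bound; the exchange of integrals for the covariance needs one bound of each kind.\<close>

lemma integral_abs_centred_step_product_le:
  shows "(\<integral>t. \<bar>centred_step \<mu> z1 t * centred_step \<mu> z2 t\<bar> \<partial>lborel) \<le> \<bar>z1\<bar> + (\<integral>w. \<bar>w\<bar> \<partial>\<mu>)"
    and "(\<integral>t. \<bar>centred_step \<mu> z1 t * centred_step \<mu> z2 t\<bar> \<partial>lborel) \<le> \<bar>z2\<bar> + (\<integral>w. \<bar>w\<bar> \<partial>\<mu>)"
proof -
  have *: "(\<integral>t. \<bar>centred_step \<mu> z1 t * centred_step \<mu> z2 t\<bar> \<partial>lborel) \<le> \<bar>z1\<bar> + (\<integral>w. \<bar>w\<bar> \<partial>\<mu>)" for z1 z2
  proof -
    have "(\<integral>t. \<bar>centred_step \<mu> z1 t * centred_step \<mu> z2 t\<bar> \<partial>lborel)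
        \<le> (\<integral>t. \<bar>centred_step \<mu> z1 t\<bar> \<partial>lborel)"
      by (intro integral_mono integrable_abs integrable_centred_step_product integrable_centred_step)
         (auto simp: abs_mult intro!: mult_left_le abs_centred_step_le_1)
    also note integral_abs_centred_step_le
    finally show ?thesis .
  qed
  show "(\<integral>t. \<bar>centred_step \<mu> z1 t * centred_step \<mu> z2 t\<bar> \<partial>lborel) \<le> \<bar>z1\<bar> + (\<integral>w. \<bar>w\<bar> \<partial>\<mu>)"
    by (rule *)
  show "(\<integral>t. \<bar>centred_step \<mu> z1 t * centred_step \<mu> z2 t\<bar> \<partial>lborel) \<le> \<bar>z2\<bar> + (\<integral>w. \<bar>w\<bar> \<partial>\<mu>)"
    using *[of z2 z1] by (simp add: mult.commute)
qed

lemma interval_measure_cdf: "interval_measure (cdf \<mu>) = \<mu>"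
  by (intro cdf_unique real_distribution_interval_measure cdf_interval_measure
      cdf_nondecreasing cdf_is_right_cont cdf_lim_at_bot cdf_lim_at_top_prob
      real_distribution_axioms)

text \<open>Averaging the polarised identity over the two independent copies turns each subtracted step into
  its mean, the distribution function. In absolute value the integrand is at most the first
  factor, whose integral is a distance with finite mean; this
  makes the averages exchangeable with the integral.\<close>

lemma bergsma_kernel_eq:
  "bergsma_kernel (cdf \<mu>) z1 z2
     = (\<integral>t. centred_step \<mu> z1 t * centred_step \<mu> z2 t \<partial>lborel)"
proof -
  note \<mu>_sigma_finite = sigma_finite_measure_axioms
  interpret \<mu>\<mu>: pair_prob_space \<mu> \<mu> ..
  interpret pair_sigma_finite "\<mu> \<Otimes>\<^sub>M \<mu>" lborel ..
  let ?f = "\<lambda>Z t. (step z1 t - step (fst Z) t) * (step z2 t - step (snd Z) t)"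
  have hbi: "has_bochner_integral lborel (?f Z)
     (- (1 / 2) * (\<bar>z1 - z2\<bar> - \<bar>z1 - snd Z\<bar> - \<bar>fst Z - z2\<bar> + \<bar>fst Z - snd Z\<bar>))" for Z
    by (rule has_bochner_integral_step_product)
  have abs_le: "(\<integral>t. norm (?f Z t) \<partial>lborel) \<le> \<bar>z1 - fst Z\<bar>" for Z
  proof -
    have "(\<integral>t. norm (?f Z t) \<partial>lborel) \<le> (\<integral>t. \<bar>step z1 t - step (fst Z) t\<bar> \<partial>lborel)"
      using hbi[of Z] has_bochner_integral_step_dist[of z1 "fst Z"]
      by (intro integral_mono integrable_norm)
         (auto simp: has_bochner_integral_iff abs_mult step_def)
    then show ?thesis
      using has_bochner_integral_step_dist[of z1 "fst Z"] by (simp add: has_bochner_integral_iff)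
  qed
  have int: "integrable ((\<mu> \<Otimes>\<^sub>M \<mu>) \<Otimes>\<^sub>M lborel) (case_prod ?f)"
  proof (rule Fubini_integrable)
    have "integrable (\<mu> \<Otimes>\<^sub>M \<mu>) (\<lambda>Z. \<bar>z1 - fst Z\<bar>)"
      using has_bochner_integral_pair_mult[OF \<mu>_sigma_finite \<mu>_sigma_finite integrable_dist[of z1],
          of "\<lambda>_. 1"]
      by (simp add: has_bochner_integral_iff case_prod_unfold)
    then show "integrable (\<mu> \<Otimes>\<^sub>M \<mu>) (\<lambda>Z. \<integral>t. norm (case_prod ?f (Z, t)) \<partial>lborel)"
      by (rule Bochner_Integration.integrable_bound)
         (use abs_le in \<open>auto intro!: lborel.borel_measurable_lebesgue_integral\<close>)
    show "AE Z in \<mu> \<Otimes>\<^sub>M \<mu>. integrable lborel (\<lambda>t. case_prod ?f (Z, t))"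
      using hbi by (auto simp: has_bochner_integral_iff)
  qed simp
  have inner: "(\<integral>Z. ?f Z t \<partial>(\<mu> \<Otimes>\<^sub>M \<mu>)) = centred_step \<mu> z1 t * centred_step \<mu> z2 t" for t
    using has_bochner_integral_pair_mult[OF \<mu>_sigma_finite \<mu>_sigma_finite,
        of "\<lambda>w. step z1 t - step w t" "\<lambda>w. step z2 t - step w t"]
      has_bochner_integral_step_diff
    by (simp add: has_bochner_integral_iff case_prod_unfold)
  have "bergsma_kernel (cdf \<mu>) z1 z2 = (\<integral>Z. (\<integral>t. ?f Z t \<partial>lborel) \<partial>(\<mu> \<Otimes>\<^sub>M \<mu>))"
    using hbi by (simp add: bergsma_kernel_def interval_measure_cdf has_bochner_integral_iff)
  also have "\<dots> = (\<integral>t. (\<integral>Z. ?f Z t \<partial>(\<mu> \<Otimes>\<^sub>M \<mu>)) \<partial>lborel)"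
    using Fubini_integral[OF int] by simp
  finally show ?thesis by (simp only: inner)
qed

end

section \<open>Bergsma's covariance as a squared distance from independence\<close>

context prob_space
begin

lemma finite_mean_distribution_distr:
  assumes "integrable M X"
  shows "finite_mean_distribution (distr M borel X)"
  using assms
  by (auto simp: finite_mean_distribution_def finite_mean_distribution_axioms_def integrable_distr_eq)

lemma expectation_centred_step_product:
  assumes X: "integrable M X" and Y: "integrable M Y"
  shows "expectation (\<lambda>\<omega>. centred_step (distr M borel X) (X \<omega>) s
        * centred_step (distr M borel Y) (Y \<omega>) t)
    = prob {\<omega> \<in> space M. X \<omega> \<le> s \<and> Y \<omega> \<le> t} - cdf (distr M borel X) s * cdf (distr M borel Y) t"
proof -
  have [measurable]: "X \<in> borel_measurable M" "Y \<in> borel_measurable M"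
    using X Y by auto
  have E: "integrable M (indicator A :: _ \<Rightarrow> real) \<and> expectation (indicator A) = prob A"
    if "A \<in> events" for A
    using that by (simp add: less_top[symmetric])
  let ?A = "{\<omega> \<in> space M. X \<omega> \<le> s}" and ?B = "{\<omega> \<in> space M. Y \<omega> \<le> t}"
    and ?C = "{\<omega> \<in> space M. X \<omega> \<le> s \<and> Y \<omega> \<le> t}"
  have F: "cdf (distr M borel X) s = prob ?A" "cdf (distr M borel Y) t = prob ?B"
    by (simp_all add: cdf_def measure_distr vimage_def Int_def conj_commute)
  have "expectation (\<lambda>\<omega>. centred_step (distr M borel X) (X \<omega>) s
        * centred_step (distr M borel Y) (Y \<omega>) t)
    = expectation (\<lambda>\<omega>. indicator ?C \<omega> - prob ?B * indicator ?A \<omega>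
        - prob ?A * indicator ?B \<omega> + prob ?A * prob ?B)"
    by (intro Bochner_Integration.integral_cong)
       (auto simp: centred_step_def step_def F algebra_simps split: split_indicator)
  also have "\<dots> = prob ?C - prob ?A * prob ?B"
    using E[of ?A] E[of ?B] E[of ?C] by (simp add: prob_space algebra_simps)
  finally show ?thesis by (simp add: F)
qed

text \<open>Both kernels are integrals over the real line, so their product is an integral over the plane, and
  the expectation over the two copies of the pair is taken inside that integral. There the
  integrand is a function of the first copy times the same function of the second, which gives a
  square. The exchange is legitimate because the first kernel can be bounded through
  $X_1$ alone and the second through $Y_2$ alone: these are independent, so the product of the bounds
  is integrable although only first moments of $X$ and $Y$ are assumed.\<close>

theorem bergsma_cov_has_integral:
  assumes X: "integrable M X" and Y: "integrable M Y"
  shows "has_bochner_integral (lborel \<Otimes>\<^sub>M lborel)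
    (\<lambda>(s, t). (prob {\<omega> \<in> space M. X \<omega> \<le> s \<and> Y \<omega> \<le> t}
       - cdf (distr M borel X) s * cdf (distr M borel Y) t)\<^sup>2) (bergsma_cov M X Y)"
proof -
  have [measurable]: "X \<in> borel_measurable M" "Y \<in> borel_measurable M"
    using X Y by auto
  define \<mu> where "\<mu> = distr M borel X"
  define \<nu> where "\<nu> = distr M borel Y"
  define P where "P = distr M (borel \<Otimes>\<^sub>M borel) (\<lambda>\<omega>. (X \<omega>, Y \<omega>))"
  interpret \<mu>: finite_mean_distribution \<mu>
    unfolding \<mu>_def by (rule finite_mean_distribution_distr[OF X])
  interpret \<nu>: finite_mean_distribution \<nu>
    unfolding \<nu>_def by (rule finite_mean_distribution_distr[OF Y])
  interpret P: prob_space P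
    unfolding P_def by (rule prob_space_distr) measurable
  note P_sigma_finite = P.sigma_finite_measure_axioms
  interpret PP: pair_prob_space P P ..
  interpret pair_sigma_finite "P \<Otimes>\<^sub>M P" "lborel \<Otimes>\<^sub>M lborel :: (real \<times> real) measure"
    by (simp add: pair_sigma_finite_def lborel_pair.sigma_finite_measure_axioms PP.P.sigma_finite_measure_axioms)
  have [measurable_cong]: "sets P = sets (borel \<Otimes>\<^sub>M borel)"
    by (simp add: P_def)
  let ?a = "\<lambda>\<omega> s. centred_step \<mu> (fst (fst \<omega>)) s * centred_step \<mu> (fst (snd \<omega>)) s"
  let ?b = "\<lambda>\<omega> t. centred_step \<nu> (snd (fst \<omega>)) t * centred_step \<nu> (snd (snd \<omega>)) t"
  let ?G = "\<lambda>\<omega> st. ?a \<omega> (fst st) * ?b \<omega> (snd st)"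
  have mean: "integrable P (\<lambda>p. \<bar>fst p\<bar> + (\<integral>w. \<bar>w\<bar> \<partial>\<mu>))"
    "integrable P (\<lambda>p. \<bar>snd p\<bar> + (\<integral>w. \<bar>w\<bar> \<partial>\<nu>))"
    unfolding P_def by (subst integrable_distr_eq; use X Y in simp)+
  have G: "has_bochner_integral (lborel \<Otimes>\<^sub>M lborel) (?G \<omega>)
      (bergsma_kernel (cdf \<mu>) (fst (fst \<omega>)) (fst (snd \<omega>))
        * bergsma_kernel (cdf \<nu>) (snd (fst \<omega>)) (snd (snd \<omega>)))" for \<omega>
    using has_bochner_integral_pair_mult[OF lborel.sigma_finite_measure_axioms
        lborel.sigma_finite_measure_axioms \<mu>.integrable_centred_step_product
        \<nu>.integrable_centred_step_product]
    by (simp add: \<mu>.bergsma_kernel_eq \<nu>.bergsma_kernel_eq case_prod_unfold)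
  \<comment> \<open>Bound the first factor through the first copy and the second through the second copy.\<close>
  have norm_G: "(\<integral>st. norm (?G \<omega> st) \<partial>(lborel \<Otimes>\<^sub>M lborel))
      \<le> (\<bar>fst (fst \<omega>)\<bar> + (\<integral>w. \<bar>w\<bar> \<partial>\<mu>)) * (\<bar>snd (snd \<omega>)\<bar> + (\<integral>w. \<bar>w\<bar> \<partial>\<nu>))" for \<omega>
  proof -
    have "(\<integral>st. norm (?G \<omega> st) \<partial>(lborel \<Otimes>\<^sub>M lborel))
        = (\<integral>s. \<bar>?a \<omega> s\<bar> \<partial>lborel) * (\<integral>t. \<bar>?b \<omega> t\<bar> \<partial>lborel)"
      using has_bochner_integral_pair_mult[OF lborel.sigma_finite_measure_axioms
          lborel.sigma_finite_measure_axioms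
          integrable_abs[OF \<mu>.integrable_centred_step_product]
          integrable_abs[OF \<nu>.integrable_centred_step_product]]
      by (simp add: case_prod_unfold has_bochner_integral_iff abs_mult)
    also have "\<dots> \<le> (\<bar>fst (fst \<omega>)\<bar> + (\<integral>w. \<bar>w\<bar> \<partial>\<mu>)) * (\<bar>snd (snd \<omega>)\<bar> + (\<integral>w. \<bar>w\<bar> \<partial>\<nu>))"
      by (intro mult_mono \<mu>.integral_abs_centred_step_product_le
          \<nu>.integral_abs_centred_step_product_le) auto
    finally show ?thesis .
  qed
  have int: "integrable ((P \<Otimes>\<^sub>M P) \<Otimes>\<^sub>M (lborel \<Otimes>\<^sub>M lborel)) (case_prod ?G)"
  proof (rule Fubini_integrable)
    have "integrable (P \<Otimes>\<^sub>M P)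
        (\<lambda>\<omega>. (\<bar>fst (fst \<omega>)\<bar> + (\<integral>w. \<bar>w\<bar> \<partial>\<mu>)) * (\<bar>snd (snd \<omega>)\<bar> + (\<integral>w. \<bar>w\<bar> \<partial>\<nu>)))"
      using has_bochner_integral_pair_mult[OF P_sigma_finite P_sigma_finite mean]
      by (simp add: has_bochner_integral_iff case_prod_unfold)
    then show "integrable (P \<Otimes>\<^sub>M P) (\<lambda>\<omega>. \<integral>st. norm (case_prod ?G (\<omega>, st)) \<partial>(lborel \<Otimes>\<^sub>M lborel))"
    proof (rule Bochner_Integration.integrable_bound)
      show "AE \<omega> in P \<Otimes>\<^sub>M P. norm (\<integral>st. norm (case_prod ?G (\<omega>, st)) \<partial>(lborel \<Otimes>\<^sub>M lborel))
        \<le> norm ((\<bar>fst (fst \<omega>)\<bar> + (\<integral>w. \<bar>w\<bar> \<partial>\<mu>)) * (\<bar>snd (snd \<omega>)\<bar> + (\<integral>w. \<bar>w\<bar> \<partial>\<nu>)))"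
        using norm_G by (intro AE_I2) (simp add: order_trans[OF _ abs_ge_self])
    qed (intro lborel_pair.borel_measurable_lebesgue_integral, measurable)
    show "AE \<omega> in P \<Otimes>\<^sub>M P. integrable (lborel \<Otimes>\<^sub>M lborel) (\<lambda>st. case_prod ?G (\<omega>, st))"
      using G by (simp add: has_bochner_integral_iff)
  qed simp
  have EG: "(\<integral>\<omega>. ?G \<omega> st \<partial>(P \<Otimes>\<^sub>M P))
      = (prob {\<omega> \<in> space M. X \<omega> \<le> fst st \<and> Y \<omega> \<le> snd st} - cdf \<mu> (fst st) * cdf \<nu> (snd st))\<^sup>2"
    for st
  proof -
    let ?g = "\<lambda>p. centred_step \<mu> (fst p) (fst st) * centred_step \<nu> (snd p) (snd st)"
    have g: "integrable P ?g"
      by (rule P.integrable_const_bound[where B=1])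
         (auto simp: abs_mult intro!: mult_le_one \<mu>.abs_centred_step_le_1 \<nu>.abs_centred_step_le_1)
    have "(\<integral>\<omega>. ?G \<omega> st \<partial>(P \<Otimes>\<^sub>M P)) = (integral\<^sup>L P ?g)\<^sup>2"
      using has_bochner_integral_pair_mult[OF P_sigma_finite P_sigma_finite g g]
      by (simp add: has_bochner_integral_iff case_prod_unfold power2_eq_square mult_ac)
    also have "integral\<^sup>L P ?g = expectation (\<lambda>\<omega>. centred_step \<mu> (X \<omega>) (fst st)
        * centred_step \<nu> (Y \<omega>) (snd st))"
      unfolding P_def by (subst integral_distr) auto
    finally show ?thesis
      using expectation_centred_step_product[OF X Y] by (simp add: \<mu>_def \<nu>_def)
  qed
  have "bergsma_cov M X Y = (\<integral>\<omega>. (\<integral>st. ?G \<omega> st \<partial>(lborel \<Otimes>\<^sub>M lborel)) \<partial>(P \<Otimes>\<^sub>M P))"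
    using G by (simp add: bergsma_cov_def Let_def \<mu>_def[symmetric] \<nu>_def[symmetric] P_def[symmetric]
        has_bochner_integral_iff case_prod_unfold)
  also have "\<dots> = (\<integral>st. (\<integral>\<omega>. ?G \<omega> st \<partial>(P \<Otimes>\<^sub>M P)) \<partial>(lborel \<Otimes>\<^sub>M lborel))"
    using Fubini_integral[OF int] by simp
  finally show ?thesis
    using integrable_snd[OF int]
    unfolding EG case_prod_unfold \<mu>_def[symmetric] \<nu>_def[symmetric]
    by (simp add: has_bochner_integral_iff)
qed

end

section \<open>Gumbel's bivariate exponential distribution\<close>

lemma has_gbed_commute:
  assumes "has_gbed M X Y \<theta>"
  shows "has_gbed M Y X \<theta>"
proof -
  have "gbed_cdf \<theta> x y = gbed_cdf \<theta> y x" for x y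
    by (simp add: gbed_cdf_def algebra_simps)
  then show ?thesis
    using assms by (simp add: has_gbed_def conj_commute)
qed

text \<open>The marginal is the limit of the joint distribution function as the other argument tends to
  infinity; the mixed exponential term vanishes in the limit because $\theta \ge 0$.\<close>

lemma gbed_marginal_prob:
  assumes gbed: "has_gbed M X Y \<theta>" and "0 \<le> \<theta>"
  shows "measure M {\<omega> \<in> space M. X \<omega> \<le> x} = (if 0 < x then 1 - exp (- x) else 0)"
proof -
  interpret prob_space M using gbed by (simp add: has_gbed_def)
  have [measurable]: "X \<in> borel_measurable M" "Y \<in> borel_measurable M"
    using gbed by (auto simp: has_gbed_def)
  let ?A = "\<lambda>n::nat. {\<omega> \<in> space M. X \<omega> \<le> x \<and> Y \<omega> \<le> real n}"
  have "(\<lambda>n. prob (?A n)) \<longlonglongrightarrow> prob (\<Union>n. ?A n)"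
    by (intro finite_Lim_measure_incseq) (auto simp: incseq_def)
  also have "(\<Union>n. ?A n) = {\<omega> \<in> space M. X \<omega> \<le> x}"
    using real_arch_simple by blast
  finally have "(\<lambda>n. gbed_cdf \<theta> x (real n)) \<longlonglongrightarrow> prob {\<omega> \<in> space M. X \<omega> \<le> x}"
    using gbed by (simp add: has_gbed_def)
  moreover have "(\<lambda>n. gbed_cdf \<theta> x (real n)) \<longlonglongrightarrow> (if 0 < x then 1 - exp (- x) else 0)"
  proof (cases "0 < x")
    case True
    have exp0: "(\<lambda>n. exp (- real n)) \<longlonglongrightarrow> 0"
      by (intro filterlim_compose[OF exp_at_bot] filterlim_compose[OF filterlim_uminus_at_bot_at_top]
          filterlim_real_sequentially)
    have "exp (- (x + real n + \<theta> * x * real n)) \<le> exp (- real n)" for n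
    proof -
      have "0 \<le> \<theta> * x * real n"
        using True \<open>0 \<le> \<theta>\<close> by (intro mult_nonneg_nonneg) auto
      then show ?thesis using True by auto
    qed
    then have "(\<lambda>n. exp (- (x + real n + \<theta> * x * real n))) \<longlonglongrightarrow> 0"
      by (intro tendsto_sandwich[OF _ _ tendsto_const exp0]) auto
    then have "(\<lambda>n. 1 - exp (- x) - exp (- real n) + exp (- (x + real n + \<theta> * x * real n)))
        \<longlonglongrightarrow> 1 - exp (- x) - 0 + 0"
      by (intro tendsto_intros exp0)
    moreover have "\<forall>\<^sub>F n in sequentially. 
        1 - exp (- x) - exp (- real n) + exp (- (x + real n + \<theta> * x * real n)) = gbed_cdf \<theta> x (real n)"
      using eventually_gt_at_top[of 0] by eventually_elim (use True in \<open>simp add: gbed_cdf_def\<close>)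
    ultimately show ?thesis
      using True by (auto elim: Lim_transform_eventually)
  qed (simp add: gbed_cdf_def)
  ultimately show ?thesis by (rule LIMSEQ_unique)
qed

lemma gbed_marginal_cdf:
  assumes gbed: "has_gbed M X Y \<theta>" and "0 \<le> \<theta>"
  shows "cdf (distr M borel X) x = (if 0 < x then 1 - exp (- x) else 0)"
proof -
  have [measurable]: "X \<in> borel_measurable M"
    using gbed by (auto simp: has_gbed_def)
  show ?thesis
    unfolding gbed_marginal_prob[OF assms, symmetric]
    by (simp add: cdf_def measure_distr vimage_def Int_def conj_commute)
qed

lemma gbed_integrable:
  assumes gbed: "has_gbed M X Y \<theta>" and "0 \<le> \<theta>"
  shows "integrable M X"
proof -
  interpret prob_space M using gbed by (simp add: has_gbed_def)
  have "distributed M lborel X (exponential_density 1)"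
    using gbed gbed_marginal_prob[OF assms]
    by (subst exponential_distributed_iff) (auto simp: has_gbed_def)
  then show ?thesis
    using erlang_ith_moment_integrable[of 1 X 0 1] by simp
qed

text \<open>This is $F_1(x) F_2(y) - F_{12}(x,y)$, the product minus the joint distribution function: with
  this sign it is nonnegative for $\theta \ge 0$, so squaring preserves comparisons.\<close>

definition gbed_dependence :: "real \<Rightarrow> real \<times> real \<Rightarrow> real" where
  "gbed_dependence \<theta> =
     (\<lambda>(x, y). if 0 < x \<and> 0 < y then exp (- (x + y)) * (1 - exp (- (\<theta> * x * y))) else 0)"

lemma gbed_dependence_mono:
  assumes "0 \<le> \<theta>" "\<theta> \<le> \<theta>'"
  shows "(gbed_dependence \<theta> p)\<^sup>2 \<le> (gbed_dependence \<theta>' p)\<^sup>2"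
  using assms
  by (auto simp: gbed_dependence_def split: prod.split intro!: power_mono mult_left_mono mult_right_mono)

lemma gbed_dependence_strict_mono:
  assumes "0 \<le> \<theta>" "\<theta> < \<theta>'" "0 < x" "0 < y"
  shows "(gbed_dependence \<theta> (x, y))\<^sup>2 < (gbed_dependence \<theta>' (x, y))\<^sup>2"
  using assms by (auto simp: gbed_dependence_def intro!: power_strict_mono)

lemma gbed_bergsma_cov:
  assumes gbed: "has_gbed M X Y \<theta>" and \<theta>: "0 \<le> \<theta>"
  shows "has_bochner_integral (lborel \<Otimes>\<^sub>M lborel) (\<lambda>p. (gbed_dependence \<theta> p)\<^sup>2) (bergsma_cov M X Y)"
proof -
  interpret prob_space M using gbed by (simp add: has_gbed_def)
  have "measure M {\<omega> \<in> space M. X \<omega> \<le> x \<and> Y \<omega> \<le> y}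
      - cdf (distr M borel X) x * cdf (distr M borel Y) y = - gbed_dependence \<theta> (x, y)" for x y
    using gbed gbed_marginal_cdf[OF gbed \<theta>] gbed_marginal_cdf[OF has_gbed_commute[OF gbed] \<theta>]
    by (simp add: has_gbed_def gbed_cdf_def gbed_dependence_def algebra_simps exp_add[symmetric])
  then show ?thesis
    using bergsma_cov_has_integral[OF gbed_integrable[OF gbed \<theta>]
        gbed_integrable[OF has_gbed_commute[OF gbed] \<theta>]]
    by (simp add: case_prod_unfold)
qed

theorem lemma1:
  fixes M :: "real \<Rightarrow> 'a measure" and X Y :: "real \<Rightarrow> 'a \<Rightarrow> real"
  assumes "\<And>\<theta>. 0 \<le> \<theta> \<Longrightarrow> \<theta> \<le> 1 \<Longrightarrow> has_gbed (M \<theta>) (X \<theta>) (Y \<theta>) \<theta>"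
  shows "strict_mono_on {0<..<1} (\<lambda>\<theta>. bergsma_cov (M \<theta>) (X \<theta>) (Y \<theta>))"
proof (rule strict_mono_onI)
  fix \<theta> \<theta>' :: real assume \<theta>: "\<theta> \<in> {0<..<1}" "\<theta>' \<in> {0<..<1}" "\<theta> < \<theta>'"
  let ?L = "lborel \<Otimes>\<^sub>M lborel :: (real \<times> real) measure"
  let ?K = "\<lambda>\<theta>. bergsma_cov (M \<theta>) (X \<theta>) (Y \<theta>)"
  let ?d = "\<lambda>p. (gbed_dependence \<theta>' p)\<^sup>2 - (gbed_dependence \<theta> p)\<^sup>2"
  have d: "has_bochner_integral ?L ?d (?K \<theta>' - ?K \<theta>)"
    using \<theta> by (intro has_bochner_integral_diff gbed_bergsma_cov assms) auto
  have nonneg: "0 \<le> ?d p" for p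
    using gbed_dependence_mono[of \<theta> \<theta>'] \<theta> by simp
  have "?K \<theta>' - ?K \<theta> = integral\<^sup>L ?L ?d" and int: "integrable ?L ?d"
    using d by (auto simp: has_bochner_integral_iff)
  moreover have "0 \<le> integral\<^sup>L ?L ?d"
    using nonneg by (simp add: integral_nonneg_AE)
  moreover have "integral\<^sup>L ?L ?d \<noteq> 0"
  proof
    assume "integral\<^sup>L ?L ?d = 0"
    then have "AE p in ?L. ?d p = 0"
      using integral_nonneg_eq_0_iff_AE[OF int] nonneg by simp
    \<comment> \<open>The increase is positive on the whole open quadrant; the unit square has measure 1.\<close>
    then have "AE p in ?L. p \<notin> {0<..<1} \<times> {0<..<1}"
    proof eventually_elim
      case (elim p)
      show ?case
        using elim gbed_dependence_strict_mono[of \<theta> \<theta>' "fst p" "snd p"] \<theta>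
        by (cases p) auto
    qed
    then have "emeasure ?L ({0<..<1} \<times> {0<..<1}) = 0"
      by (subst (asm) AE_iff_measurable[where N="{0<..<1} \<times> {0<..<1}"]) (auto simp: space_pair_measure)
    then show False
      by (simp add: lborel.emeasure_pair_measure_Times)
  qed
  ultimately show "?K \<theta> < ?K \<theta>'" by simp
qed

end
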